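(* Let $\Delta$ be an additive subgroup of $\mathbb{C}$, let $0\neq b\in\Delta$, and let $\mathcal{A}=\mathcal{A}_{\Delta,\{0\}}$ be the complex vector space with basis $\{x_\alpha\mid\alpha\in\Delta\}$ and Novikov product $x_\alpha\circ x_\beta=(\beta+b)x_{\alpha+\beta}$. Consider, for a group homomorphism $\varphi:\Delta\to\mathbb{C}$ (additive groups) and a skew-symmetric map $\theta:\Delta\times\Delta\to\mathbb{C}$, the bracket $$[x_\alpha,x_\beta]=\theta(\alpha,\beta)x_{\alpha+\beta+b}+\frac1b\big((\alpha+b)\varphi(\beta)-(\beta+b)\varphi(\alpha)\big)x_{\alpha+\beta}\qquad\text{for }\alpha,\beta\in\Delta,\qquad(1)$$ and the conditions, for all $\alpha,\beta,\gamma\in\Delta$, $$(\alpha+b)\big(\theta(\alpha+\gamma,\beta)-\theta(\gamma,\beta)-\theta(\alpha,\beta)\big)=(\beta+b)\big(\theta(\beta+\gamma,\alpha)-\theta(\gamma,\alpha)-\theta(\beta,\alpha)\big),\qquad(2)$$ $$\theta(\alpha,\beta)\theta(\alpha+\beta+b,\gamma)+\theta(\beta,\gamma)\theta(\beta+\gamma+b,\alpha)+\theta(\gamma,\alpha)\theta(\gamma+\alpha+b,\beta)=0.\qquad(3)$$ (i) Any Lie algebra over the Novikov algebra $(\mathcal{A},\circ)$ has its Lie bracket of the form (1), where $\varphi:\Delta\to\mathbb{C}$ is a group homomorphism, $\theta\equiv0$ if $\varphi(b)\neq0$, and $\theta$ is a skew-symmetric map satisfying (2) and (3) if $\varphi(b)=0$.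 (ii) Conversely, for any group homomorphism $\varphi:\Delta\to\mathbb{C}$ and any skew-symmetric map $\theta:\Delta\times\Delta\to\mathbb{C}$ such that $\theta\equiv0$ if $\varphi(b)\neq0$, and (2), (3) hold if $\varphi(b)=0$, formula (1) defines a Lie algebra over the Novikov algebra $(\mathcal{A},\circ)$. (iii) In particular, (1) defines a Lie algebra over $(\mathcal{A},\circ)$ for any group homomorphism $\varphi:\Delta\to\mathbb{C}$ with $\varphi(b)=0$ and any skew-symmetric $\mathbb{Z}$-bilinear map $\theta:\Delta\times\Delta\to\mathbb{C}$ of one of the following two kinds: either $\theta(b,\beta)=0$ for all $\beta\in\Delta$ (i.e. $b\in\mathrm{Rad}_\theta$); or $\theta(\alpha,\beta)=\varphi_1(\alpha)\varphi_2(\beta)-\varphi_1(\beta)\varphi_2(\alpha)$ for all $\alpha,\beta\in\Delta$, where $\varphi_1,\varphi_2:\Delta\to\mathbb{C}$ are group homomorphisms with $\varphi_1(b)=0$ and $\varphi_2(b)=-1$.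
   Context: A Novikov algebra $(\mathcal{A},\circ)$ (over $\mathbb{C}$) satisfies $(u\circ v)\circ w=(u\circ w)\circ v$ and $(u,v,w)=(v,u,w)$, where $(u,v,w)=(u\circ v)\circ w-u\circ(v\circ w)$. A Gel'fand-Dorfman bialgebra is a triple $(\mathcal{A},[\cdot,\cdot],\circ)$ such that $(\mathcal{A},[\cdot,\cdot])$ is a Lie algebra, $(\mathcal{A},\circ)$ is a Novikov algebra and $$[w\circ u,v]-[w\circ v,u]+[w,u]\circ v-[w,v]\circ u-w\circ[u,v]=0\quad\text{for all }u,v,w\in\mathcal{A}.$$ "$(\mathcal{A},[\cdot,\cdot])$ is a Lie algebra over the Novikov algebra $(\mathcal{A},\circ)$" means that $(\mathcal{A},[\cdot,\cdot],\circ)$ is a Gel'fand-Dorfman bialgebra. Skew-symmetric means $\theta(\alpha,\beta)=-\theta(\beta,\alpha)$. *)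

theory Defs
  imports Complex_Main "HOL-Library.Poly_Mapping"
begin

locale bilinear_algebra = vector_space scale
  for scale :: "complex \<Rightarrow> 'v::ab_group_add \<Rightarrow> 'v" +
  fixes A :: "'v set" and mul :: "'v \<Rightarrow> 'v \<Rightarrow> 'v"
  assumes subspace_A: "subspace A"
    and mul_closed: "\<lbrakk>u \<in> A; v \<in> A\<rbrakk> \<Longrightarrow> mul u v \<in> A"
    and mul_add_left: "\<lbrakk>u \<in> A; v \<in> A; w \<in> A\<rbrakk> \<Longrightarrow> mul (u + v) w = mul u w + mul v w"
    and mul_add_right: "\<lbrakk>u \<in> A; v \<in> A; w \<in> A\<rbrakk> \<Longrightarrow> mul u (v + w) = mul u v + mul u w"
    and mul_scale_left: "\<lbrakk>u \<in> A; v \<in> A\<rbrakk> \<Longrightarrow> mul (scale c u) v = scale c (mul u v)"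
    and mul_scale_right: "\<lbrakk>u \<in> A; v \<in> A\<rbrakk> \<Longrightarrow> mul u (scale c v) = scale c (mul u v)"

locale novikov_algebra = bilinear_algebra +
  assumes right_commute: "\<lbrakk>u \<in> A; v \<in> A; w \<in> A\<rbrakk> \<Longrightarrow> mul (mul u v) w = mul (mul u w) v"
    and associator_sym: "\<lbrakk>u \<in> A; v \<in> A; w \<in> A\<rbrakk> \<Longrightarrow>
      mul (mul u v) w - mul u (mul v w) = mul (mul v u) w - mul v (mul u w)"

locale lie_algebra = bilinear_algebra scale A br
  for scale :: "complex \<Rightarrow> 'v::ab_group_add \<Rightarrow> 'v" and A :: "'v set"
    and br :: "'v \<Rightarrow> 'v \<Rightarrow> 'v" +
  assumes alternating: "u \<in> A \<Longrightarrow> br u u = 0"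
    and jacobi: "\<lbrakk>u \<in> A; v \<in> A; w \<in> A\<rbrakk> \<Longrightarrow>
      br (br u v) w + br (br v w) u + br (br w u) v = 0"

locale gelfand_dorfman_bialgebra =
  lie: lie_algebra scale A br + nov: novikov_algebra scale A mul
  for scale :: "complex \<Rightarrow> 'v::ab_group_add \<Rightarrow> 'v" and A :: "'v set"
    and br :: "'v \<Rightarrow> 'v \<Rightarrow> 'v" and mul :: "'v \<Rightarrow> 'v \<Rightarrow> 'v" +
  assumes compatible: "\<lbrakk>u \<in> A; v \<in> A; w \<in> A\<rbrakk> \<Longrightarrow>
    br (mul w u) v - br (mul w v) u + mul (br w u) v - mul (br w v) u - mul w (br u v) = 0"

definition scaleF :: "complex \<Rightarrow> (complex \<Rightarrow>\<^sub>0 complex) \<Rightarrow> (complex \<Rightarrow>\<^sub>0 complex)"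
  where "scaleF c u = Poly_Mapping.map ((*) c) u"

definition xb :: "complex \<Rightarrow> (complex \<Rightarrow>\<^sub>0 complex)"
  where "xb \<alpha> = Poly_Mapping.single \<alpha> 1"

definition spaceF :: "complex set \<Rightarrow> (complex \<Rightarrow>\<^sub>0 complex) set"
  where "spaceF \<Delta> = {u. Poly_Mapping.keys u \<subseteq> \<Delta>}"

definition bilinear_extension ::
    "(complex \<Rightarrow> complex \<Rightarrow> (complex \<Rightarrow>\<^sub>0 complex)) \<Rightarrow>
      (complex \<Rightarrow>\<^sub>0 complex) \<Rightarrow> (complex \<Rightarrow>\<^sub>0 complex) \<Rightarrow> (complex \<Rightarrow>\<^sub>0 complex)"
  where "bilinear_extension f u v =
    (\<Sum>\<alpha>\<in>Poly_Mapping.keys u. \<Sum>\<beta>\<in>Poly_Mapping.keys v.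
      scaleF (Poly_Mapping.lookup u \<alpha> * Poly_Mapping.lookup v \<beta>) (f \<alpha> \<beta>))"

lemma lookup_scaleF [simp]:
  "Poly_Mapping.lookup (scaleF c u) k = c * Poly_Mapping.lookup u k"
  by (simp add: scaleF_def Poly_Mapping.map.rep_eq when_def)

lemma vector_space_scaleF: "vector_space scaleF"
  by unfold_locales
    (auto intro!: poly_mapping_eqI simp: lookup_add algebra_simps)

interpretation freeF: vector_space scaleF
  by (rule vector_space_scaleF)

lemma inj_xb: "inj xb"
  by (rule injI) (metis xb_def lookup_single_eq lookup_single_not_eq zero_neq_one)

lemma lookup_sum_scaleF_xb:
  assumes "finite S"
  shows "Poly_Mapping.lookup (\<Sum>\<alpha>\<in>S. scaleF (c \<alpha>) (xb \<alpha>)) k = (if k \<in> S then c k else 0)"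
proof -
  have "Poly_Mapping.lookup (\<Sum>\<alpha>\<in>S. scaleF (c \<alpha>) (xb \<alpha>)) k
      = (\<Sum>\<alpha>\<in>S. if \<alpha> = k then c \<alpha> else 0)"
    by (auto simp: lookup_sum xb_def lookup_single when_def intro!: sum.cong)
  then show ?thesis
    using assms by (simp add: sum.delta)
qed

lemma independent_xb: "\<not> freeF.dependent (xb ` \<Delta>)"
proof
  assume "freeF.dependent (xb ` \<Delta>)"
  then obtain T r v where T: "finite T" "T \<subseteq> xb ` \<Delta>" "v \<in> T" "r v \<noteq> 0"
    and 0: "(\<Sum>w\<in>T. scaleF (r w) w) = 0"
    unfolding freeF.dependent_explicit by auto
  obtain S where S: "T = xb ` S"
    using T(2) by (auto simp: subset_image_iff)
  have inj: "inj_on xb S"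
    using inj_xb by (rule inj_on_subset) simp
  have fin: "finite S"
    using T(1) S inj by (simp add: finite_image_iff)
  obtain k where k: "k \<in> S" "v = xb k"
    using T(3) S by auto
  have "(\<Sum>\<alpha>\<in>S. scaleF (r (xb \<alpha>)) (xb \<alpha>)) = 0"
    using 0 S inj by (simp add: sum.reindex)
  then have "r (xb k) = 0"
    using lookup_sum_scaleF_xb[OF fin, of "\<lambda>\<alpha>. r (xb \<alpha>)" k] k by simp
  then show False
    using T(4) k by simp
qed

lemma subspace_spaceF: "freeF.subspace (spaceF \<Delta>)"
  unfolding freeF.subspace_def spaceF_def
  by (auto simp: in_keys_iff subset_iff lookup_add, metis add_0)

lemma span_xb: "freeF.span (xb ` \<Delta>) = spaceF \<Delta>"
proof
  show "freeF.span (xb ` \<Delta>) \<subseteq> spaceF \<Delta>"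
    by (rule freeF.span_minimal[OF _ subspace_spaceF]) (auto simp: spaceF_def xb_def)
  show "spaceF \<Delta> \<subseteq> freeF.span (xb ` \<Delta>)"
  proof
    fix u assume u: "u \<in> spaceF \<Delta>"
    have "u = (\<Sum>\<alpha>\<in>Poly_Mapping.keys u. scaleF (Poly_Mapping.lookup u \<alpha>) (xb \<alpha>))"
      by (rule poly_mapping_eqI) (simp add: lookup_sum_scaleF_xb in_keys_iff)
    also have "\<dots> \<in> freeF.span (xb ` \<Delta>)"
      using u by (intro freeF.span_sum freeF.span_scale freeF.span_base) (auto simp: spaceF_def)
    finally show "u \<in> freeF.span (xb ` \<Delta>)" .
  qed
qed

lemma bilinear_extension_xb: "bilinear_extension f (xb \<alpha>) (xb \<beta>) = f \<alpha> \<beta>"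
  by (simp add: bilinear_extension_def xb_def)

definition nov_product ::
    "complex \<Rightarrow> (complex \<Rightarrow>\<^sub>0 complex) \<Rightarrow> (complex \<Rightarrow>\<^sub>0 complex) \<Rightarrow> (complex \<Rightarrow>\<^sub>0 complex)"
  where "nov_product b = bilinear_extension (\<lambda>\<alpha> \<beta>. scaleF (\<beta> + b) (xb (\<alpha> + \<beta>)))"

definition basis_bracket ::
    "complex \<Rightarrow> (complex \<Rightarrow> complex) \<Rightarrow> (complex \<Rightarrow> complex \<Rightarrow> complex) \<Rightarrow>
      complex \<Rightarrow> complex \<Rightarrow> (complex \<Rightarrow>\<^sub>0 complex)"
  where "basis_bracket b \<phi> \<theta> \<alpha> \<beta> =
    scaleF (\<theta> \<alpha> \<beta>) (xb (\<alpha> + \<beta> + b)) +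
    scaleF (1 / b * ((\<alpha> + b) * \<phi> \<beta> - (\<beta> + b) * \<phi> \<alpha>)) (xb (\<alpha> + \<beta>))"

text \<open>Maps on \<open>\<Delta>\<close> are total functions on the complex numbers;
  only their values on \<open>\<Delta>\<close> matter.\<close>

definition additive_subgroup_of :: "complex set \<Rightarrow> bool"
  where "additive_subgroup_of \<Delta> \<longleftrightarrow>
    0 \<in> \<Delta> \<and> (\<forall>\<alpha>\<in>\<Delta>. \<forall>\<beta>\<in>\<Delta>. \<alpha> + \<beta> \<in> \<Delta>) \<and> (\<forall>\<alpha>\<in>\<Delta>. - \<alpha> \<in> \<Delta>)"

definition hom_on :: "complex set \<Rightarrow> (complex \<Rightarrow> complex) \<Rightarrow> bool"
  where "hom_on \<Delta> \<phi> \<longleftrightarrow> (\<forall>\<alpha>\<in>\<Delta>. \<forall>\<beta>\<in>\<Delta>. \<phi> (\<alpha> + \<beta>) = \<phi> \<alpha> + \<phi> \<beta>)"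

definition skew_on :: "complex set \<Rightarrow> (complex \<Rightarrow> complex \<Rightarrow> complex) \<Rightarrow> bool"
  where "skew_on \<Delta> \<theta> \<longleftrightarrow> (\<forall>\<alpha>\<in>\<Delta>. \<forall>\<beta>\<in>\<Delta>. \<theta> \<alpha> \<beta> = - \<theta> \<beta> \<alpha>)"

definition zero_on :: "complex set \<Rightarrow> (complex \<Rightarrow> complex \<Rightarrow> complex) \<Rightarrow> bool"
  where "zero_on \<Delta> \<theta> \<longleftrightarrow> (\<forall>\<alpha>\<in>\<Delta>. \<forall>\<beta>\<in>\<Delta>. \<theta> \<alpha> \<beta> = 0)"

definition int_bilinear_on :: "complex set \<Rightarrow> (complex \<Rightarrow> complex \<Rightarrow> complex) \<Rightarrow> bool"
  where "int_bilinear_on \<Delta> \<theta> \<longleftrightarrow>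
    (\<forall>\<alpha>\<in>\<Delta>. hom_on \<Delta> (\<theta> \<alpha>)) \<and> (\<forall>\<beta>\<in>\<Delta>. hom_on \<Delta> (\<lambda>\<alpha>. \<theta> \<alpha> \<beta>))"

definition theta_compat ::
    "complex set \<Rightarrow> complex \<Rightarrow> (complex \<Rightarrow> complex \<Rightarrow> complex) \<Rightarrow> bool"
  where "theta_compat \<Delta> b \<theta> \<longleftrightarrow> (\<forall>\<alpha>\<in>\<Delta>. \<forall>\<beta>\<in>\<Delta>. \<forall>\<gamma>\<in>\<Delta>.
    (\<alpha> + b) * (\<theta> (\<alpha> + \<gamma>) \<beta> - \<theta> \<gamma> \<beta> - \<theta> \<alpha> \<beta>) =
    (\<beta> + b) * (\<theta> (\<beta> + \<gamma>) \<alpha> - \<theta> \<gamma> \<alpha> - \<theta> \<beta> \<alpha>))"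

definition theta_jacobi ::
    "complex set \<Rightarrow> complex \<Rightarrow> (complex \<Rightarrow> complex \<Rightarrow> complex) \<Rightarrow> bool"
  where "theta_jacobi \<Delta> b \<theta> \<longleftrightarrow> (\<forall>\<alpha>\<in>\<Delta>. \<forall>\<beta>\<in>\<Delta>. \<forall>\<gamma>\<in>\<Delta>.
    \<theta> \<alpha> \<beta> * \<theta> (\<alpha> + \<beta> + b) \<gamma> + \<theta> \<beta> \<gamma> * \<theta> (\<beta> + \<gamma> + b) \<alpha> +
    \<theta> \<gamma> \<alpha> * \<theta> (\<gamma> + \<alpha> + b) \<beta> = 0)"

end

theory Submission
  imports Defs
begin

text \<open>
  Compare coefficients of \<open>x\<^bsub>\<alpha>+\<beta>+\<gamma>+\<delta>\<^esub>\<close> in the compatibility condition for \<open>x\<^sub>\<gamma>, x\<^sub>\<alpha>, x\<^sub>\<beta>\<close>: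
  the coefficient \<open>f\<^sub>\<delta>(\<alpha>,\<beta>)\<close> of \<open>x\<^bsub>\<alpha>+\<beta>+\<delta>\<^esub>\<close> in \<open>[x\<^sub>\<alpha>,x\<^sub>\<beta>]\<close> satisfies an equation for each
  \<open>\<delta>\<close> separately. Its case \<open>\<gamma> = 0\<close> reads
  \<open>(b - \<delta>) f\<^sub>\<delta>(\<alpha>,\<beta>) = (\<alpha> + b) f\<^sub>\<delta>(0,\<beta>) - (\<beta> + b) f\<^sub>\<delta>(0,\<alpha>)\<close>,
  and at \<open>\<alpha> = 0\<close> this becomes \<open>\<delta> f\<^sub>\<delta>(0,\<beta>) = 0\<close>; hence only \<open>\<delta> = 0\<close> and \<open>\<delta> = b\<close> survive.
  The coefficients for \<open>\<delta> = 0\<close> are governed by \<open>\<phi> = f\<^sub>0(0,-)\<close>, and those for \<open>\<delta> = b\<close> form \<open>\<theta>\<close>.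

  In the Jacobi identity the part of degree \<open>0\<close> vanishes, the part of degree \<open>2b\<close> is
  condition (3), and the part of degree \<open>b\<close> collapses, by condition (2), to
  \<open>\<phi>(b)\<close> times the cyclic sum of \<open>(\<gamma> + b) \<theta>(\<alpha>,\<beta>)\<close>. At \<open>\<gamma> = 0\<close> that cyclic sum is \<open>b \<theta>(\<alpha>,\<beta>)\<close>.
\<close>

subsection \<open>Bilinear extensions\<close>

lemma xb_in_spaceF: "\<alpha> \<in> \<Delta> \<Longrightarrow> xb \<alpha> \<in> spaceF \<Delta>"
  by (auto simp: spaceF_def xb_def)

lemma lookup_xb: "Poly_Mapping.lookup (xb \<alpha>) k = (if k = \<alpha> then 1 else 0)"
  by (auto simp: xb_def lookup_single when_def)

lemma additive_subgroup_ofD: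
  assumes "additive_subgroup_of \<Delta>"
  shows "0 \<in> \<Delta>" "\<alpha> \<in> \<Delta> \<Longrightarrow> \<beta> \<in> \<Delta> \<Longrightarrow> \<alpha> + \<beta> \<in> \<Delta>" "\<alpha> \<in> \<Delta> \<Longrightarrow> - \<alpha> \<in> \<Delta>"
  using assms by (auto simp: additive_subgroup_of_def)

text \<open>The added terms have coefficient 0. Larger index sets are wanted because the supports of
  \<open>u\<close>, \<open>v\<close> and \<open>u + v\<close> differ, and sums can be compared
  termwise only over common sets.\<close>

lemma bilinear_extension_superset:
  assumes "finite S" "finite T" "Poly_Mapping.keys u \<subseteq> S" "Poly_Mapping.keys v \<subseteq> T"
  shows "bilinear_extension f u v =
    (\<Sum>\<alpha>\<in>S. \<Sum>\<beta>\<in>T. scaleF (Poly_Mapping.lookup u \<alpha> * Poly_Mapping.lookup v \<beta>) (f \<alpha> \<beta>))"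
proof -
  have "(\<Sum>\<alpha>\<in>S. \<Sum>\<beta>\<in>T. scaleF (Poly_Mapping.lookup u \<alpha> * Poly_Mapping.lookup v \<beta>) (f \<alpha> \<beta>))
    = (\<Sum>\<alpha>\<in>Poly_Mapping.keys u. \<Sum>\<beta>\<in>T. scaleF (Poly_Mapping.lookup u \<alpha> * Poly_Mapping.lookup v \<beta>) (f \<alpha> \<beta>))"
    using assms by (intro sum.mono_neutral_right) (auto simp: in_keys_iff)
  also have "\<dots> = bilinear_extension f u v"
    unfolding bilinear_extension_def using assms
    by (intro sum.cong refl sum.mono_neutral_right) (auto simp: in_keys_iff)
  finally show ?thesis ..
qed

lemma bilinear_extension_add_left:
  "bilinear_extension f (u + v) w = bilinear_extension f u w + bilinear_extension f v w"
proof -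
  let ?S = "Poly_Mapping.keys u \<union> Poly_Mapping.keys v" and ?T = "Poly_Mapping.keys w"
  have "Poly_Mapping.keys (u + v) \<subseteq> ?S"
    by (rule Poly_Mapping.keys_add)
  then show ?thesis
    by (simp add: bilinear_extension_superset[of ?S ?T] lookup_add ring_distribs
        freeF.scale_left_distrib sum.distrib)
qed

lemma bilinear_extension_add_right:
  "bilinear_extension f w (u + v) = bilinear_extension f w u + bilinear_extension f w v"
proof -
  let ?S = "Poly_Mapping.keys u \<union> Poly_Mapping.keys v" and ?T = "Poly_Mapping.keys w"
  have "Poly_Mapping.keys (u + v) \<subseteq> ?S"
    by (rule Poly_Mapping.keys_add)
  then show ?thesis
    by (simp add: bilinear_extension_superset[of ?T ?S] lookup_add ring_distribs
        freeF.scale_left_distrib sum.distrib)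
qed

lemma keys_scaleF: "Poly_Mapping.keys (scaleF c u) \<subseteq> Poly_Mapping.keys u"
  by (auto simp: in_keys_iff)

lemma bilinear_extension_scale_left:
  "bilinear_extension f (scaleF c u) v = scaleF c (bilinear_extension f u v)"
  using keys_scaleF[of c u]
  by (simp add: bilinear_extension_superset[of "Poly_Mapping.keys u" "Poly_Mapping.keys v"]
      freeF.scale_sum_right mult.assoc)

lemma bilinear_extension_scale_right:
  "bilinear_extension f u (scaleF c v) = scaleF c (bilinear_extension f u v)"
  using keys_scaleF[of c v]
  by (simp add: bilinear_extension_superset[of "Poly_Mapping.keys u" "Poly_Mapping.keys v"]
      freeF.scale_sum_right mult.left_commute)

lemmas bilinear_extension_simps =
  bilinear_extension_add_left bilinear_extension_add_right
  bilinear_extension_scale_left bilinear_extension_scale_right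
  freeF.scale_right_distrib freeF.scale_right_diff_distrib

lemma linear_scaleF_iff:
  "Vector_Spaces.linear scaleF scaleF F \<longleftrightarrow>
    (\<forall>u v. F (u + v) = F u + F v) \<and> (\<forall>c u. F (scaleF c u) = scaleF c (F u))"
  by (simp add: Vector_Spaces.linear_iff vector_space_scaleF)

lemma bilinear_algebra_bilinear_extension:
  assumes "\<And>\<alpha> \<beta>. \<alpha> \<in> \<Delta> \<Longrightarrow> \<beta> \<in> \<Delta> \<Longrightarrow> f \<alpha> \<beta> \<in> spaceF \<Delta>"
  shows "bilinear_algebra scaleF (spaceF \<Delta>) (bilinear_extension f)"
proof
  show "bilinear_extension f u v \<in> spaceF \<Delta>" if "u \<in> spaceF \<Delta>" "v \<in> spaceF \<Delta>" for u v
    unfolding bilinear_extension_def using that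
    by (intro freeF.subspace_sum freeF.subspace_scale subspace_spaceF assms)
      (auto simp: spaceF_def)
qed (simp_all add: bilinear_extension_simps subspace_spaceF)

section \<open>Reduction of multilinear identities to basis vectors\<close>

lemma linear_eq_0_on_spaceF:
  assumes "Vector_Spaces.linear scaleF scaleF F" and "\<And>\<alpha>. \<alpha> \<in> \<Delta> \<Longrightarrow> F (xb \<alpha>) = 0"
    and "u \<in> spaceF \<Delta>"
  shows "F u = 0"
proof -
  interpret Vector_Spaces.linear scaleF scaleF F by fact
  show ?thesis
    using assms(2,3) eq_0_on_span[of "xb ` \<Delta>" u] by (auto simp: span_xb)
qed

text \<open>The arguments are released from the basis one at a time, each by linearity with the
  other two fixed.\<close>

lemma trilinear_eq_0_on_spaceF:
  assumes "\<And>v w. Vector_Spaces.linear scaleF scaleF (\<lambda>u. F u v w)"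
    and "\<And>u w. Vector_Spaces.linear scaleF scaleF (\<lambda>v. F u v w)"
    and "\<And>u v. Vector_Spaces.linear scaleF scaleF (\<lambda>w. F u v w)"
    and "\<And>\<alpha> \<beta> \<gamma>. \<alpha> \<in> \<Delta> \<Longrightarrow> \<beta> \<in> \<Delta> \<Longrightarrow> \<gamma> \<in> \<Delta> \<Longrightarrow> F (xb \<alpha>) (xb \<beta>) (xb \<gamma>) = 0"
    and "u \<in> spaceF \<Delta>" "v \<in> spaceF \<Delta>" "w \<in> spaceF \<Delta>"
  shows "F u v w = 0"
proof -
  have 1: "F u (xb \<beta>) (xb \<gamma>) = 0" if "\<beta> \<in> \<Delta>" "\<gamma> \<in> \<Delta>" for \<beta> \<gamma>
    by (rule linear_eq_0_on_spaceF[OF assms(1,4,5)]) (use that in auto)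
  have 2: "F u v (xb \<gamma>) = 0" if "\<gamma> \<in> \<Delta>" for \<gamma>
    by (rule linear_eq_0_on_spaceF[OF assms(2) 1 assms(6)]) (use that in auto)
  show ?thesis
    by (rule linear_eq_0_on_spaceF[OF assms(3) 2 assms(7)])
qed

lemma bilinear_eq_0_on_spaceF:
  assumes "\<And>v. Vector_Spaces.linear scaleF scaleF (\<lambda>u. F u v)"
    and "\<And>u. Vector_Spaces.linear scaleF scaleF (\<lambda>v. F u v)"
    and "\<And>\<alpha> \<beta>. \<alpha> \<in> \<Delta> \<Longrightarrow> \<beta> \<in> \<Delta> \<Longrightarrow> F (xb \<alpha>) (xb \<beta>) = 0"
    and "u \<in> spaceF \<Delta>" "v \<in> spaceF \<Delta>"
  shows "F u v = 0"
proof -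
  have "F u (xb \<beta>) = 0" if "\<beta> \<in> \<Delta>" for \<beta>
    by (rule linear_eq_0_on_spaceF[OF assms(1,3,4)]) (use that in auto)
  from linear_eq_0_on_spaceF[OF assms(2) this assms(5)] show ?thesis .
qed

subsection \<open>The Novikov algebra\<close>

lemma nov_product_xb: "nov_product b (xb \<alpha>) (xb \<beta>) = scaleF (\<beta> + b) (xb (\<alpha> + \<beta>))"
  by (simp add: nov_product_def bilinear_extension_xb)

lemma nov_product_simps:
  "nov_product b (u + v) w = nov_product b u w + nov_product b v w"
  "nov_product b w (u + v) = nov_product b w u + nov_product b w v"
  "nov_product b (scaleF c u) v = scaleF c (nov_product b u v)"
  "nov_product b u (scaleF c v) = scaleF c (nov_product b u v)"
  by (simp_all add: nov_product_def bilinear_extension_simps)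

lemma lookup_nov_product_xb_right:
  "Poly_Mapping.lookup (nov_product b u (xb \<beta>)) k = (\<beta> + b) * Poly_Mapping.lookup u (k - \<beta>)"
proof -
  have "Poly_Mapping.lookup (nov_product b u (xb \<beta>)) k =
     (\<Sum>\<alpha>\<in>Poly_Mapping.keys u. if \<alpha> = k - \<beta> then (\<beta> + b) * Poly_Mapping.lookup u \<alpha> else 0)"
    unfolding nov_product_def bilinear_extension_def lookup_sum
    by (intro sum.cong refl) (auto simp: xb_def lookup_single when_def)
  then show ?thesis
    by (simp add: sum.delta in_keys_iff)
qed

lemma lookup_nov_product_xb_left:
  "Poly_Mapping.lookup (nov_product b (xb \<gamma>) v) k =
    (k - \<gamma> + b) * Poly_Mapping.lookup v (k - \<gamma>)"
proof -
  have "Poly_Mapping.lookup (nov_product b (xb \<gamma>) v) k =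
     (\<Sum>\<alpha>\<in>Poly_Mapping.keys v. if \<alpha> = k - \<gamma> then (\<alpha> + b) * Poly_Mapping.lookup v \<alpha> else 0)"
    unfolding nov_product_def bilinear_extension_def lookup_sum
    \<comment> \<open>The outer sum runs over the one-element support of \<open>xb \<gamma>\<close>;
      the swap leaves a single sum over the support of \<open>v\<close>.\<close>
    by (subst sum.swap) (intro sum.cong refl, auto simp: xb_def lookup_single when_def)
  then show ?thesis
    by (simp add: sum.delta in_keys_iff)
qed

text \<open>On basis vectors, a product \<open>(u v) w\<close> has the factor
  \<open>(\<beta> + b) * (\<gamma> + b)\<close>, symmetric in the last two indices. The associator
  has the factor \<open>- \<gamma> * (\<gamma> + b)\<close>, which does not involve the first
  two.\<close>

lemma novikov_algebra_nov_product:
  assumes \<Delta>: "additive_subgroup_of \<Delta>"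
  shows "novikov_algebra scaleF (spaceF \<Delta>) (nov_product b)"
proof -
  interpret bilinear_algebra scaleF "spaceF \<Delta>" "nov_product b"
    unfolding nov_product_def
    by (intro bilinear_algebra_bilinear_extension freeF.subspace_scale subspace_spaceF
        xb_in_spaceF additive_subgroup_ofD(2)[OF \<Delta>])
  show ?thesis
  proof
    fix u v w assume uvw: "u \<in> spaceF \<Delta>" "v \<in> spaceF \<Delta>" "w \<in> spaceF \<Delta>"
    let ?m = "nov_product b"
    have "?m (?m u v) w - ?m (?m u w) v = 0"
      by (rule trilinear_eq_0_on_spaceF[OF _ _ _ _ uvw])
        (simp_all add: linear_scaleF_iff nov_product_simps nov_product_xb ac_simps
          freeF.scale_right_diff_distrib)
    then show "?m (?m u v) w = ?m (?m u w) v" by simp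
    have "?m (?m u v) w - ?m u (?m v w) - (?m (?m v u) w - ?m v (?m u w)) = 0"
      by (rule trilinear_eq_0_on_spaceF[OF _ _ _ _ uvw])
        (simp_all add: linear_scaleF_iff nov_product_simps nov_product_xb algebra_simps
          freeF.scale_right_distrib freeF.scale_left_distrib
          freeF.scale_right_diff_distrib freeF.scale_left_diff_distrib)
    then show "?m (?m u v) w - ?m u (?m v w) = ?m (?m v u) w - ?m v (?m u w)" by simp
  qed
qed

subsection \<open>Brackets given by the formula\<close>

definition phi_coeff :: "complex \<Rightarrow> (complex \<Rightarrow> complex) \<Rightarrow> complex \<Rightarrow> complex \<Rightarrow> complex"
  where "phi_coeff b \<phi> \<alpha> \<beta> = 1 / b * ((\<alpha> + b) * \<phi> \<beta> - (\<beta> + b) * \<phi> \<alpha>)"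

lemma basis_bracket_eq:
  "basis_bracket b \<phi> \<theta> \<alpha> \<beta> =
    scaleF (\<theta> \<alpha> \<beta>) (xb (\<alpha> + \<beta> + b)) + scaleF (phi_coeff b \<phi> \<alpha> \<beta>) (xb (\<alpha> + \<beta>))"
  by (simp add: basis_bracket_def phi_coeff_def)

section \<open>The Jacobi identity and compatibility on basis vectors\<close>

lemma bracket_bracket_xb:
  assumes "bilinear_algebra scaleF (spaceF \<Delta>) br"
    and br: "\<And>\<alpha> \<beta>. \<alpha> \<in> \<Delta> \<Longrightarrow> \<beta> \<in> \<Delta> \<Longrightarrow> br (xb \<alpha>) (xb \<beta>) = basis_bracket b \<phi> \<theta> \<alpha> \<beta>"
    and \<Delta>: "additive_subgroup_of \<Delta>" and "b \<in> \<Delta>" "\<alpha> \<in> \<Delta>" "\<beta> \<in> \<Delta>" "\<gamma> \<in> \<Delta>"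
  shows "br (br (xb \<alpha>) (xb \<beta>)) (xb \<gamma>) =
    scaleF (\<theta> \<alpha> \<beta> * \<theta> (\<alpha> + \<beta> + b) \<gamma>) (xb (\<alpha> + \<beta> + \<gamma> + 2 * b)) +
    scaleF (\<theta> \<alpha> \<beta> * phi_coeff b \<phi> (\<alpha> + \<beta> + b) \<gamma> + phi_coeff b \<phi> \<alpha> \<beta> * \<theta> (\<alpha> + \<beta>) \<gamma>)
      (xb (\<alpha> + \<beta> + \<gamma> + b)) +
    scaleF (phi_coeff b \<phi> \<alpha> \<beta> * phi_coeff b \<phi> (\<alpha> + \<beta>) \<gamma>) (xb (\<alpha> + \<beta> + \<gamma>))"
proof -
  interpret bilinear_algebra scaleF "spaceF \<Delta>" br by fact
  have "\<alpha> + \<beta> \<in> \<Delta>" "\<alpha> + \<beta> + b \<in> \<Delta>"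
    using assms(4-6) by (simp_all add: additive_subgroup_ofD(2)[OF \<Delta>])
  then have "br (br (xb \<alpha>) (xb \<beta>)) (xb \<gamma>) =
      scaleF (\<theta> \<alpha> \<beta>) (basis_bracket b \<phi> \<theta> (\<alpha> + \<beta> + b) \<gamma>) +
      scaleF (phi_coeff b \<phi> \<alpha> \<beta>) (basis_bracket b \<phi> \<theta> (\<alpha> + \<beta>) \<gamma>)"
    using assms(5-)
    by (simp add: br basis_bracket_eq[of b \<phi> \<theta> \<alpha> \<beta>] mul_add_left mul_scale_left xb_in_spaceF
        freeF.subspace_scale[OF subspace_spaceF])
  then show ?thesis
    by (simp add: basis_bracket_eq freeF.scale_right_distrib freeF.scale_left_distrib ac_simps)
qed

text \<open>Up to \<open>1 / b\<close>, the coefficient is the determinant [\<alpha>,\<beta>] of the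
  vectors \<open>(\<alpha> + b, \<phi> \<alpha>)\<close> and
  \<open>(\<beta> + b, \<phi> \<beta>)\<close>. The vector of \<alpha> + \<beta> is the sum of these
  minus \<open>(b, 0)\<close>. The products of two determinants cancel in the cyclic sum; what
  remains is -b times the cyclic sum of [\<alpha>,\<beta>] \<open>\<phi> \<gamma>\<close>, a 3 by 3
  determinant with a repeated column.\<close>

lemma phi_coeff_jacobi:
  assumes "hom_on \<Delta> \<phi>" "\<alpha> \<in> \<Delta>" "\<beta> \<in> \<Delta>" "\<gamma> \<in> \<Delta>"
  shows "phi_coeff b \<phi> \<alpha> \<beta> * phi_coeff b \<phi> (\<alpha> + \<beta>) \<gamma> +
    phi_coeff b \<phi> \<beta> \<gamma> * phi_coeff b \<phi> (\<beta> + \<gamma>) \<alpha> +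
    phi_coeff b \<phi> \<gamma> \<alpha> * phi_coeff b \<phi> (\<gamma> + \<alpha>) \<beta> = 0"
  using assms unfolding phi_coeff_def hom_on_def
  by (simp add: algebra_simps)

lemma phi_theta_jacobi:
  assumes "hom_on \<Delta> \<phi>" "skew_on \<Delta> \<theta>" "theta_compat \<Delta> b \<theta>" "additive_subgroup_of \<Delta>" "b \<in> \<Delta>"
    and \<Delta>: "\<alpha> \<in> \<Delta>" "\<beta> \<in> \<Delta>" "\<gamma> \<in> \<Delta>" and "b \<noteq> 0"
  shows "(\<theta> \<alpha> \<beta> * phi_coeff b \<phi> (\<alpha> + \<beta> + b) \<gamma> + phi_coeff b \<phi> \<alpha> \<beta> * \<theta> (\<alpha> + \<beta>) \<gamma>) +
    (\<theta> \<beta> \<gamma> * phi_coeff b \<phi> (\<beta> + \<gamma> + b) \<alpha> + phi_coeff b \<phi> \<beta> \<gamma> * \<theta> (\<beta> + \<gamma>) \<alpha>) +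
    (\<theta> \<gamma> \<alpha> * phi_coeff b \<phi> (\<gamma> + \<alpha> + b) \<beta> + phi_coeff b \<phi> \<gamma> \<alpha> * \<theta> (\<gamma> + \<alpha>) \<beta>) =
    - (\<phi> b / b) * ((\<gamma> + b) * \<theta> \<alpha> \<beta> + (\<alpha> + b) * \<theta> \<beta> \<gamma> + (\<beta> + b) * \<theta> \<gamma> \<alpha>)" (is "?L = ?R")
proof -
  have hom: "\<phi> (x + y) = \<phi> x + \<phi> y" if "x \<in> \<Delta>" "y \<in> \<Delta>" for x y
    using assms(1) that by (simp add: hom_on_def)
  \<comment> \<open>\<open>D = 0\<close> is condition (2); up to sign, it is the coefficient of each of
    \<open>\<phi> \<alpha>\<close>, \<open>\<phi> \<beta>\<close>, \<open>\<phi> \<gamma>\<close> in \<open>b\<close> times the left-hand side.\<close>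
  define D where "D x y z = (x + b) * (\<theta> (x + z) y - \<theta> z y - \<theta> x y) -
    (y + b) * (\<theta> (y + z) x - \<theta> z x - \<theta> y x)" for x y z
  have D: "D x y z = 0" if "x \<in> \<Delta>" "y \<in> \<Delta>" "z \<in> \<Delta>" for x y z
    using assms(3) that by (simp add: D_def theta_compat_def)
  have skew: "\<theta> \<beta> \<alpha> = - \<theta> \<alpha> \<beta>" "\<theta> \<gamma> \<beta> = - \<theta> \<beta> \<gamma>" "\<theta> \<alpha> \<gamma> = - \<theta> \<gamma> \<alpha>"
    using assms(2) \<Delta> unfolding skew_on_def by blast+
  have "\<phi> (\<alpha> + \<beta> + b) = \<phi> \<alpha> + \<phi> \<beta> + \<phi> b" "\<phi> (\<beta> + \<gamma> + b) = \<phi> \<beta> + \<phi> \<gamma> + \<phi> b"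
    "\<phi> (\<gamma> + \<alpha> + b) = \<phi> \<gamma> + \<phi> \<alpha> + \<phi> b"
    using \<Delta> \<open>b \<in> \<Delta>\<close> by (simp_all add: hom additive_subgroup_ofD(2)[OF assms(4)])
  \<comment> \<open>The factor \<open>b\<close> clears the denominators. The value
    \<open>\<phi> b\<close> enters only through \<open>\<phi> (\<alpha> + \<beta> + b)\<close> and
    its cyclic images, with coefficient \<open>- (\<gamma> + b) * \<theta> \<alpha> \<beta>\<close>;
    these terms form \<open>b * ?R\<close>.\<close>
  then have "b * ?L = b * ?R - (\<phi> \<gamma> * D \<alpha> \<beta> \<gamma> + \<phi> \<alpha> * D \<beta> \<gamma> \<alpha> + \<phi> \<beta> * D \<gamma> \<alpha> \<beta>)"
    using \<open>b \<noteq> 0\<close> unfolding phi_coeff_def D_def skew by (simp only:) (simp add: field_simps)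
  also have "\<dots> = b * ?R"
    using \<Delta> by (simp only: D) simp
  finally show ?thesis
    unfolding mult_left_cancel[OF \<open>b \<noteq> 0\<close>] .
qed

text \<open>The Jacobi sum is computed, not asserted to vanish, so that it serves both directions:
  the construction makes both coefficients zero, and the classification reads off that they are
  zero.\<close>

lemma jacobi_xb:
  assumes "bilinear_algebra scaleF (spaceF \<Delta>) br"
    and "\<And>\<alpha> \<beta>. \<alpha> \<in> \<Delta> \<Longrightarrow> \<beta> \<in> \<Delta> \<Longrightarrow> br (xb \<alpha>) (xb \<beta>) = basis_bracket b \<phi> \<theta> \<alpha> \<beta>"
    and "additive_subgroup_of \<Delta>" "b \<in> \<Delta>" "\<alpha> \<in> \<Delta>" "\<beta> \<in> \<Delta>" "\<gamma> \<in> \<Delta>"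
    and "hom_on \<Delta> \<phi>" "skew_on \<Delta> \<theta>" "theta_compat \<Delta> b \<theta>" "b \<noteq> 0"
  shows "br (br (xb \<alpha>) (xb \<beta>)) (xb \<gamma>) + br (br (xb \<beta>) (xb \<gamma>)) (xb \<alpha>) +
      br (br (xb \<gamma>) (xb \<alpha>)) (xb \<beta>) =
    scaleF (\<theta> \<alpha> \<beta> * \<theta> (\<alpha> + \<beta> + b) \<gamma> + \<theta> \<beta> \<gamma> * \<theta> (\<beta> + \<gamma> + b) \<alpha> +
      \<theta> \<gamma> \<alpha> * \<theta> (\<gamma> + \<alpha> + b) \<beta>) (xb (\<alpha> + \<beta> + \<gamma> + 2 * b)) +
    scaleF (- (\<phi> b / b) * ((\<gamma> + b) * \<theta> \<alpha> \<beta> + (\<alpha> + b) * \<theta> \<beta> \<gamma> + (\<beta> + b) * \<theta> \<gamma> \<alpha>))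
      (xb (\<alpha> + \<beta> + \<gamma> + b))"
proof -
  let ?p = "phi_coeff b \<phi>"
  let ?s = "\<alpha> + \<beta> + \<gamma>"
  have cyc: "\<beta> + \<gamma> + \<alpha> = ?s" "\<gamma> + \<alpha> + \<beta> = ?s"
    by simp_all
  have collect: "scaleF t\<^sub>1 X + scaleF s\<^sub>1 Y + scaleF p\<^sub>1 Z + (scaleF t\<^sub>2 X + scaleF s\<^sub>2 Y + scaleF p\<^sub>2 Z) +
      (scaleF t\<^sub>3 X + scaleF s\<^sub>3 Y + scaleF p\<^sub>3 Z) =
    scaleF (t\<^sub>1 + t\<^sub>2 + t\<^sub>3) X + scaleF (s\<^sub>1 + s\<^sub>2 + s\<^sub>3) Y + scaleF (p\<^sub>1 + p\<^sub>2 + p\<^sub>3) Z"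
    for t\<^sub>1 s\<^sub>1 p\<^sub>1 t\<^sub>2 s\<^sub>2 p\<^sub>2 t\<^sub>3 s\<^sub>3 p\<^sub>3 X Y Z
    by (simp add: freeF.scale_left_distrib ac_simps)
  have *: "br (br (xb x) (xb y)) (xb z) =
      scaleF (\<theta> x y * \<theta> (x + y + b) z) (xb (x + y + z + 2 * b)) +
      scaleF (\<theta> x y * ?p (x + y + b) z + ?p x y * \<theta> (x + y) z) (xb (x + y + z + b)) +
      scaleF (?p x y * ?p (x + y) z) (xb (x + y + z))"
    if "x \<in> \<Delta>" "y \<in> \<Delta>" "z \<in> \<Delta>" for x y z
    by (rule bracket_bracket_xb[OF assms(1) _ assms(3,4) that]) (rule assms(2))
  show ?thesis
    unfolding *[OF assms(5,6,7)] *[OF assms(6,7,5)] *[OF assms(7,5,6)]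
      cyc collect phi_coeff_jacobi[OF assms(8,5,6,7)]
      phi_theta_jacobi[OF assms(8,9,10,3,4,5,6,7,11)]
    by simp
qed

lemma compatible_xb:
  assumes "bilinear_algebra scaleF (spaceF \<Delta>) br"
    and br: "\<And>\<alpha> \<beta>. \<alpha> \<in> \<Delta> \<Longrightarrow> \<beta> \<in> \<Delta> \<Longrightarrow> br (xb \<alpha>) (xb \<beta>) = basis_bracket b \<phi> \<theta> \<alpha> \<beta>"
    and \<Delta>: "additive_subgroup_of \<Delta>" and "\<alpha> \<in> \<Delta>" "\<beta> \<in> \<Delta>" "\<gamma> \<in> \<Delta>"
    and "hom_on \<Delta> \<phi>" "skew_on \<Delta> \<theta>" "theta_compat \<Delta> b \<theta>" "b \<noteq> 0"
  shows "br (nov_product b (xb \<gamma>) (xb \<alpha>)) (xb \<beta>) - br (nov_product b (xb \<gamma>) (xb \<beta>)) (xb \<alpha>) +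
    nov_product b (br (xb \<gamma>) (xb \<alpha>)) (xb \<beta>) - nov_product b (br (xb \<gamma>) (xb \<beta>)) (xb \<alpha>) -
    nov_product b (xb \<gamma>) (br (xb \<alpha>) (xb \<beta>)) = 0" (is "?lhs = 0")
proof -
  interpret bilinear_algebra scaleF "spaceF \<Delta>" br by fact
  let ?p = "phi_coeff b \<phi>"
  have hom: "\<phi> (x + y) = \<phi> x + \<phi> y" if "x \<in> \<Delta>" "y \<in> \<Delta>" for x y
    using assms(7) that by (simp add: hom_on_def)
  have in\<Delta>: "\<gamma> + \<alpha> \<in> \<Delta>" "\<gamma> + \<beta> \<in> \<Delta>"
    using assms(4-6) by (simp_all add: additive_subgroup_ofD(2)[OF \<Delta>])
  \<comment> \<open>\<open>?t\<close> and \<open>?q\<close> collect the coefficients at the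
    exponents \<alpha> + \<beta> + \<gamma> + b and \<alpha> + \<beta> + \<gamma>. The last factor
    of \<open>?t\<close> has \<open>b\<close> twice: once from the exponent \<alpha> + \<beta> + b,
    once from the product.\<close>
  let ?t = "(\<alpha> + b) * \<theta> (\<gamma> + \<alpha>) \<beta> - (\<beta> + b) * \<theta> (\<gamma> + \<beta>) \<alpha> + (\<beta> + b) * \<theta> \<gamma> \<alpha>
      - (\<alpha> + b) * \<theta> \<gamma> \<beta> - (\<alpha> + \<beta> + b + b) * \<theta> \<alpha> \<beta>"
  let ?q = "(\<alpha> + b) * ?p (\<gamma> + \<alpha>) \<beta> - (\<beta> + b) * ?p (\<gamma> + \<beta>) \<alpha> + (\<beta> + b) * ?p \<gamma> \<alpha>
      - (\<alpha> + b) * ?p \<gamma> \<beta> - (\<alpha> + \<beta> + b) * ?p \<alpha> \<beta>"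
  have "\<theta> \<beta> \<alpha> = - \<theta> \<alpha> \<beta>"
    using assms(4,5,8) unfolding skew_on_def by blast+
  moreover have "(\<alpha> + b) * (\<theta> (\<alpha> + \<gamma>) \<beta> - \<theta> \<gamma> \<beta> - \<theta> \<alpha> \<beta>) =
    (\<beta> + b) * (\<theta> (\<beta> + \<gamma>) \<alpha> - \<theta> \<gamma> \<alpha> - \<theta> \<beta> \<alpha>)"
    using assms(4,5,6,9) by (simp add: theta_compat_def)
  ultimately have t: "?t = 0"
    by (simp add: algebra_simps)
  have q: "?q = 0"
    using assms(4,5,6) \<open>b \<noteq> 0\<close> by (simp add: phi_coeff_def hom field_simps)
  have outer: "br (nov_product b (xb \<gamma>) (xb \<alpha>)) (xb \<beta>) = scaleF (\<alpha> + b) (basis_bracket b \<phi> \<theta> (\<gamma> + \<alpha>) \<beta>)"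
    "br (nov_product b (xb \<gamma>) (xb \<beta>)) (xb \<alpha>) = scaleF (\<beta> + b) (basis_bracket b \<phi> \<theta> (\<gamma> + \<beta>) \<alpha>)"
    using assms(4,5,6) in\<Delta> by (simp_all only: br nov_product_xb mul_scale_left xb_in_spaceF)
  have "?lhs = scaleF ?t (xb (\<alpha> + \<beta> + \<gamma> + b)) + scaleF ?q (xb (\<alpha> + \<beta> + \<gamma>))"
    unfolding outer br[OF assms(6,4)] br[OF assms(6,5)] br[OF assms(4,5)] basis_bracket_eq
    by (simp add: nov_product_simps nov_product_xb
        freeF.scale_right_distrib freeF.scale_left_distrib freeF.scale_left_diff_distrib
        freeF.scale_right_diff_distrib algebra_simps)
  then show ?thesis
    unfolding t q by simp
qed

text \<open>The axioms are checked on the basis. In \<open>jacobi_xb\<close> the first term vanishes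
  by \<open>theta_jacobi\<close>, the second because \<open>\<phi> b\<close> or \<theta> is
  zero.\<close>

lemma gelfand_dorfman_basis_bracket:
  assumes \<Delta>: "additive_subgroup_of \<Delta>" and "b \<in> \<Delta>" "b \<noteq> 0"
    and "hom_on \<Delta> \<phi>" and skew: "skew_on \<Delta> \<theta>"
    and "theta_compat \<Delta> b \<theta>" "theta_jacobi \<Delta> b \<theta>" and "\<phi> b = 0 \<or> zero_on \<Delta> \<theta>"
  shows "gelfand_dorfman_bialgebra scaleF (spaceF \<Delta>)
    (bilinear_extension (basis_bracket b \<phi> \<theta>)) (nov_product b)"
proof -
  let ?br = "bilinear_extension (basis_bracket b \<phi> \<theta>)"
  have bil: "bilinear_algebra scaleF (spaceF \<Delta>) ?br"
    unfolding basis_bracket_eq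
    by (intro bilinear_algebra_bilinear_extension freeF.subspace_add freeF.subspace_scale
        subspace_spaceF xb_in_spaceF additive_subgroup_ofD(2)[OF \<Delta>] \<open>b \<in> \<Delta>\<close>)
  interpret bilinear_algebra scaleF "spaceF \<Delta>" ?br by (fact bil)
  interpret nov: novikov_algebra scaleF "spaceF \<Delta>" "nov_product b"
    by (rule novikov_algebra_nov_product[OF \<Delta>])
  show ?thesis
  proof
    fix u assume u: "u \<in> spaceF \<Delta>"
    \<comment> \<open>\<open>alternating\<close> is quadratic in \<open>u\<close>, so it is not
      determined by its values on the basis; its bilinear polarisation is, and setting
      \<open>v = u\<close> gives twice the claim.\<close>
    have "?br u v + ?br v u = 0" if "v \<in> spaceF \<Delta>" for v
    proof (rule bilinear_eq_0_on_spaceF[OF _ _ _ u that])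
      fix \<alpha> \<beta> assume "\<alpha> \<in> \<Delta>" "\<beta> \<in> \<Delta>"
      then have "\<theta> \<beta> \<alpha> = - \<theta> \<alpha> \<beta>"
        using skew unfolding skew_on_def by blast+
      moreover have "phi_coeff b \<phi> \<beta> \<alpha> = - phi_coeff b \<phi> \<alpha> \<beta>"
        by (simp add: phi_coeff_def algebra_simps)
      ultimately show "?br (xb \<alpha>) (xb \<beta>) + ?br (xb \<beta>) (xb \<alpha>) = 0"
        by (simp add: bilinear_extension_xb basis_bracket_eq add.commute[of \<beta> \<alpha>])
    qed (simp_all add: linear_scaleF_iff bilinear_extension_simps)
    from this[OF u] have "scaleF 2 (?br u u) = 0"
      using freeF.scale_left_distrib[of 1 1 "?br u u"] by simp
    then show "?br u u = 0"
      by simp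
  next
    fix u v w assume uvw: "u \<in> spaceF \<Delta>" "v \<in> spaceF \<Delta>" "w \<in> spaceF \<Delta>"
    show "?br (?br u v) w + ?br (?br v w) u + ?br (?br w u) v = 0"
    proof (rule trilinear_eq_0_on_spaceF[OF _ _ _ _ uvw])
      fix \<alpha> \<beta> \<gamma> assume "\<alpha> \<in> \<Delta>" "\<beta> \<in> \<Delta>" "\<gamma> \<in> \<Delta>"
      then show "?br (?br (xb \<alpha>) (xb \<beta>)) (xb \<gamma>) + ?br (?br (xb \<beta>) (xb \<gamma>)) (xb \<alpha>) +
          ?br (?br (xb \<gamma>) (xb \<alpha>)) (xb \<beta>) = 0"
        using assms by (subst jacobi_xb[OF bil bilinear_extension_xb])
          (auto simp: theta_jacobi_def zero_on_def)
    qed (simp_all add: linear_scaleF_iff bilinear_extension_simps)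
    show "?br (nov_product b w u) v - ?br (nov_product b w v) u + nov_product b (?br w u) v
        - nov_product b (?br w v) u - nov_product b w (?br u v) = 0"
    proof (rule trilinear_eq_0_on_spaceF[OF _ _ _ _ uvw])
      fix \<alpha> \<beta> \<gamma> assume "\<alpha> \<in> \<Delta>" "\<beta> \<in> \<Delta>" "\<gamma> \<in> \<Delta>"
      then show "?br (nov_product b (xb \<gamma>) (xb \<alpha>)) (xb \<beta>) - ?br (nov_product b (xb \<gamma>) (xb \<beta>)) (xb \<alpha>) +
        nov_product b (?br (xb \<gamma>) (xb \<alpha>)) (xb \<beta>) - nov_product b (?br (xb \<gamma>) (xb \<beta>)) (xb \<alpha>) -
        nov_product b (xb \<gamma>) (?br (xb \<alpha>) (xb \<beta>)) = 0"
        using assms by (intro compatible_xb[OF bil bilinear_extension_xb])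
    qed (simp_all add: linear_scaleF_iff bilinear_extension_simps nov_product_simps algebra_simps)
  qed
qed

text \<open>Additivity makes both sides of \<open>theta_compat\<close> zero. In
  \<open>theta_jacobi\<close> it splits \<open>\<theta> (\<alpha> + \<beta> + b) \<gamma>\<close>
  into three terms; the products without \<open>b\<close> cancel cyclically by skew-symmetry, which
  leaves \<open>b_cyclic\<close>.\<close>

lemma int_bilinear_theta_conditions:
  assumes \<Delta>: "additive_subgroup_of \<Delta>" and "b \<in> \<Delta>"
    and skew: "skew_on \<Delta> \<theta>" and "int_bilinear_on \<Delta> \<theta>"
    and cases: "(\<forall>\<beta>\<in>\<Delta>. \<theta> b \<beta> = 0) \<or>
      (\<exists>\<phi>1 \<phi>2. \<phi>1 b = 0 \<and> \<phi>2 b = - 1 \<and>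
        (\<forall>\<alpha>\<in>\<Delta>. \<forall>\<beta>\<in>\<Delta>. \<theta> \<alpha> \<beta> = \<phi>1 \<alpha> * \<phi>2 \<beta> - \<phi>1 \<beta> * \<phi>2 \<alpha>))"
  shows "theta_compat \<Delta> b \<theta>" and "theta_jacobi \<Delta> b \<theta>"
proof -
  have add: "\<theta> (x + y) z = \<theta> x z + \<theta> y z" if "x \<in> \<Delta>" "y \<in> \<Delta>" "z \<in> \<Delta>" for x y z
    using assms(4) that by (simp add: int_bilinear_on_def hom_on_def)
  show "theta_compat \<Delta> b \<theta>"
    by (simp add: theta_compat_def add)
  have b_cyclic: "\<theta> \<alpha> \<beta> * \<theta> b \<gamma> + \<theta> \<beta> \<gamma> * \<theta> b \<alpha> + \<theta> \<gamma> \<alpha> * \<theta> b \<beta> = 0"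
    if "\<alpha> \<in> \<Delta>" "\<beta> \<in> \<Delta>" "\<gamma> \<in> \<Delta>" for \<alpha> \<beta> \<gamma>
    using cases
  proof
    assume "\<forall>\<beta>\<in>\<Delta>. \<theta> b \<beta> = 0"
    with that show ?thesis by simp
  next
    assume "\<exists>\<phi>1 \<phi>2. \<phi>1 b = 0 \<and> \<phi>2 b = - 1 \<and>
        (\<forall>\<alpha>\<in>\<Delta>. \<forall>\<beta>\<in>\<Delta>. \<theta> \<alpha> \<beta> = \<phi>1 \<alpha> * \<phi>2 \<beta> - \<phi>1 \<beta> * \<phi>2 \<alpha>)"
    then obtain \<phi>1 \<phi>2 where *: "\<phi>1 b = 0" "\<phi>2 b = - 1"
      "\<forall>\<alpha>\<in>\<Delta>. \<forall>\<beta>\<in>\<Delta>. \<theta> \<alpha> \<beta> = \<phi>1 \<alpha> * \<phi>2 \<beta> - \<phi>1 \<beta> * \<phi>2 \<alpha>"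
      by (elim exE conjE)
    \<comment> \<open>The values 0 and -1 at \<open>b\<close> are chosen for this. The cyclic sum
      then becomes a 3 by 3 determinant with columns \<open>\<phi>1\<close>, \<open>\<phi>2\<close>,
      \<open>\<phi>1\<close>.\<close>
    have "\<theta> b x = \<phi>1 x" if "x \<in> \<Delta>" for x
      using * \<open>b \<in> \<Delta>\<close> that by simp
    then show ?thesis
      using that by (simp add: *(3)) (simp add: algebra_simps)
  qed
  show "theta_jacobi \<Delta> b \<theta>"
    unfolding theta_jacobi_def
  proof (intro ballI)
    fix \<alpha> \<beta> \<gamma> assume in\<Delta>: "\<alpha> \<in> \<Delta>" "\<beta> \<in> \<Delta>" "\<gamma> \<in> \<Delta>"
    have "\<theta> \<beta> \<alpha> = - \<theta> \<alpha> \<beta>" "\<theta> \<gamma> \<beta> = - \<theta> \<beta> \<gamma>" "\<theta> \<alpha> \<gamma> = - \<theta> \<gamma> \<alpha>"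
      using skew in\<Delta> unfolding skew_on_def by blast+
    then show "\<theta> \<alpha> \<beta> * \<theta> (\<alpha> + \<beta> + b) \<gamma> + \<theta> \<beta> \<gamma> * \<theta> (\<beta> + \<gamma> + b) \<alpha> +
        \<theta> \<gamma> \<alpha> * \<theta> (\<gamma> + \<alpha> + b) \<beta> = 0"
      using b_cyclic[OF in\<Delta>] in\<Delta> \<open>b \<in> \<Delta>\<close>
      by (simp add: add additive_subgroup_ofD(2)[OF \<Delta>] algebra_simps)
  qed
qed

subsection \<open>Classification of the brackets\<close>

text \<open>Indexed by the shift \<delta> and not by the exponent itself: multiplication by basis
  vectors preserves the shift, so different \<delta> do not mix in the compatibility
  condition.\<close>

definition bracket_coeff :: "((complex \<Rightarrow>\<^sub>0 complex) \<Rightarrow> (complex \<Rightarrow>\<^sub>0 complex) \<Rightarrow> (complex \<Rightarrow>\<^sub>0 complex))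
    \<Rightarrow> complex \<Rightarrow> complex \<Rightarrow> complex \<Rightarrow> complex"
  where "bracket_coeff br \<delta> \<alpha> \<beta> = Poly_Mapping.lookup (br (xb \<alpha>) (xb \<beta>)) (\<alpha> + \<beta> + \<delta>)"

locale xb_bracket = gelfand_dorfman_bialgebra scaleF "spaceF \<Delta>" br "nov_product b"
  for \<Delta> :: "complex set" and br and b :: complex +
  assumes subgroup: "additive_subgroup_of \<Delta>" and b: "b \<in> \<Delta>" "b \<noteq> 0"
begin

abbreviation "f \<equiv> bracket_coeff br"

lemma zero_in: "0 \<in> \<Delta>" and add_in: "\<alpha> \<in> \<Delta> \<Longrightarrow> \<beta> \<in> \<Delta> \<Longrightarrow> \<alpha> + \<beta> \<in> \<Delta>"
  and uminus_in: "\<alpha> \<in> \<Delta> \<Longrightarrow> - \<alpha> \<in> \<Delta>"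
  using additive_subgroup_ofD[OF subgroup] by blast+

text \<open>Polarisation of \<open>alternating\<close> at \<open>u + v\<close>.\<close>

lemma bracket_skew:
  assumes "u \<in> spaceF \<Delta>" "v \<in> spaceF \<Delta>"
  shows "br v u = - br u v"
proof -
  have "br (u + v) (u + v) = br u u + br v u + (br u v + br v v)"
    using assms by (simp add: lie.mul_add_left lie.mul_add_right
        freeF.subspace_add[OF subspace_spaceF])
  then have "br v u + br u v = 0"
    using assms by (simp add: lie.alternating freeF.subspace_add[OF subspace_spaceF])
  then show ?thesis
    by (simp add: eq_neg_iff_add_eq_0)
qed

lemma coeff_skew: "\<alpha> \<in> \<Delta> \<Longrightarrow> \<beta> \<in> \<Delta> \<Longrightarrow> f \<delta> \<beta> \<alpha> = - f \<delta> \<alpha> \<beta>"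
  using bracket_skew[of "xb \<alpha>" "xb \<beta>"]
  by (simp add: bracket_coeff_def xb_in_spaceF lookup_uminus add.commute)

text \<open>Right multiplication by \<open>xb \<beta>\<close> contributes the constant \<beta> + b,
  whereas left multiplication by \<open>xb \<gamma>\<close> contributes the exponent plus
  \<open>b\<close>; hence \<delta> appears in the last factor only.\<close>

lemma coeff_compatible:
  assumes "\<alpha> \<in> \<Delta>" "\<beta> \<in> \<Delta>" "\<gamma> \<in> \<Delta>"
  shows "(\<alpha> + b) * (f \<delta> (\<alpha> + \<gamma>) \<beta> - f \<delta> \<gamma> \<beta>) - (\<beta> + b) * (f \<delta> (\<beta> + \<gamma>) \<alpha> - f \<delta> \<gamma> \<alpha>) =
    (\<alpha> + \<beta> + \<delta> + b) * f \<delta> \<alpha> \<beta>"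
proof -
  let ?k = "\<alpha> + \<beta> + \<gamma> + \<delta>"
  have "Poly_Mapping.lookup (br (nov_product b (xb \<gamma>) (xb \<alpha>)) (xb \<beta>) -
      br (nov_product b (xb \<gamma>) (xb \<beta>)) (xb \<alpha>) +
      nov_product b (br (xb \<gamma>) (xb \<alpha>)) (xb \<beta>) - nov_product b (br (xb \<gamma>) (xb \<beta>)) (xb \<alpha>) -
      nov_product b (xb \<gamma>) (br (xb \<alpha>) (xb \<beta>))) ?k = 0"
    using assms by (subst compatible) (simp_all add: xb_in_spaceF)
  moreover have "br (nov_product b (xb \<gamma>) (xb x)) (xb y) = scaleF (x + b) (br (xb (x + \<gamma>)) (xb y))"
    if "x \<in> \<Delta>" "y \<in> \<Delta>" for x y
    using that assms by (simp add: nov_product_xb lie.mul_scale_left xb_in_spaceF add_in add.commute)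
  moreover have "?k - \<beta> = \<gamma> + \<alpha> + \<delta>" "?k - \<alpha> = \<gamma> + \<beta> + \<delta>" "?k - \<gamma> = \<alpha> + \<beta> + \<delta>"
    by simp_all
  ultimately show ?thesis
    using assms
    by (simp add: lookup_add lookup_minus lookup_nov_product_xb_left lookup_nov_product_xb_right
        bracket_coeff_def algebra_simps)
qed

text \<open>At \<gamma> = 0, skew-symmetry gives \<open>f \<delta> \<alpha> \<beta>\<close> the
  factor \<alpha> + \<beta> + 2b on the left, against \<alpha> + \<beta> + \<delta> + b on the
  right.\<close>

lemma coeff_formula:
  assumes "\<alpha> \<in> \<Delta>" "\<beta> \<in> \<Delta>"
  shows "(b - \<delta>) * f \<delta> \<alpha> \<beta> = (\<alpha> + b) * f \<delta> 0 \<beta> - (\<beta> + b) * f \<delta> 0 \<alpha>"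
  using coeff_compatible[OF assms zero_in, of \<delta>] coeff_skew[OF assms, of \<delta>]
  by (simp add: algebra_simps)

lemma coeff_0_0: "f \<delta> 0 0 = 0"
  using coeff_skew[OF zero_in zero_in, of \<delta>] by simp

lemma coeff_eq_0:
  assumes "\<alpha> \<in> \<Delta>" "\<beta> \<in> \<Delta>" "\<delta> \<noteq> 0" "\<delta> \<noteq> b"
  shows "f \<delta> \<alpha> \<beta> = 0"
proof -
  have "f \<delta> 0 x = 0" if "x \<in> \<Delta>" for x
    using coeff_formula[OF zero_in that, of \<delta>] coeff_0_0 \<open>\<delta> \<noteq> 0\<close> by (simp add: algebra_simps)
  then show ?thesis
    using coeff_formula[of \<alpha> \<beta> \<delta>] assms by simp
qed

text \<open>In \<open>f 0 0\<close> the first 0 is the shift and the second a basis index; as a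
  function of the last argument it is the map \<phi> of the classification.\<close>

lemma coeff_0_eq: "\<alpha> \<in> \<Delta> \<Longrightarrow> \<beta> \<in> \<Delta> \<Longrightarrow> f 0 \<alpha> \<beta> = phi_coeff b (f 0 0) \<alpha> \<beta>"
  using coeff_formula[of \<alpha> \<beta> 0] b by (simp add: phi_coeff_def field_simps)

lemma bracket_eq:
  assumes "\<alpha> \<in> \<Delta>" "\<beta> \<in> \<Delta>"
  shows "br (xb \<alpha>) (xb \<beta>) = basis_bracket b (f 0 0) (f b) \<alpha> \<beta>"
proof (rule poly_mapping_eqI)
  fix k
  show "Poly_Mapping.lookup (br (xb \<alpha>) (xb \<beta>)) k =
      Poly_Mapping.lookup (basis_bracket b (f 0 0) (f b) \<alpha> \<beta>) k"
    \<comment> \<open>The exponent \<open>k\<close> has shift \<open>k - \<alpha> - \<beta>\<close>.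
      Since b is nonzero, the two surviving exponents are distinct and their coefficients do not
      overlap.\<close>
    using coeff_eq_0[OF assms, of "k - \<alpha> - \<beta>"] b
    by (auto simp: basis_bracket_eq coeff_0_eq[OF assms, symmetric] lookup_add lookup_xb
        bracket_coeff_def algebra_simps)
qed

lemma hom_coeff: "hom_on \<Delta> (f 0 0)"
proof -
  define \<phi> where "\<phi> = f 0 0"
  have coeff: "f 0 x y = phi_coeff b \<phi> x y" if "x \<in> \<Delta>" "y \<in> \<Delta>" for x y
    unfolding \<phi>_def using that by (rule coeff_0_eq)
  have \<phi>_0: "\<phi> 0 = 0"
    by (simp add: \<phi>_def coeff_0_0)
  have diff: "\<phi> (\<beta> + \<gamma>) = \<phi> \<gamma> + \<phi> \<beta>" if "\<beta> \<in> \<Delta>" "\<gamma> \<in> \<Delta>" "\<beta> \<noteq> - b" for \<beta> \<gamma>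
  proof -
    \<comment> \<open>Compatibility with \<alpha> = 0 and shift 0: the first difference is zero, and
      \<open>f 0 x 0 = - \<phi> x\<close> turns the rest into the additivity defect.\<close>
    have "(\<beta> + b) * (\<phi> (\<beta> + \<gamma>) - \<phi> \<gamma> - \<phi> \<beta>) = 0"
      using coeff_compatible[OF zero_in that(1,2), of 0] b that
      by (simp add: coeff zero_in add_in phi_coeff_def \<phi>_0 field_simps)
    moreover have "\<beta> + b \<noteq> 0"
      using that by (simp add: eq_neg_iff_add_eq_0)
    ultimately have "\<phi> (\<beta> + \<gamma>) - \<phi> \<gamma> - \<phi> \<beta> = 0"
      by simp
    then show ?thesis
      by (simp add: algebra_simps)
  qed
  \<comment> \<open>By symmetry, only the case where both arguments are \<open>- b\<close> escapes the cancellation of \<open>\<beta> + b\<close>.\<close>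
  have double: "\<phi> (- b + - b) = \<phi> (- b) + \<phi> (- b)"
  proof -
    \<comment> \<open>The value at -2b is reached through b + (-2b) = -b and b + (-b) = 0, where the
      first summand differs from -b.\<close>
    have "b \<noteq> - b" "- b \<in> \<Delta>" "- b + - b \<in> \<Delta>"
      using b add_in[OF uminus_in uminus_in, OF b(1) b(1)] uminus_in[OF b(1)] by simp_all
    then have "\<phi> (b + - b) = \<phi> (- b) + \<phi> b" "\<phi> (b + (- b + - b)) = \<phi> (- b + - b) + \<phi> b"
      using diff b by blast+
    then show ?thesis
      by (simp add: \<phi>_0 add_eq_0_iff)
  qed
  have "\<phi> (\<alpha> + \<beta>) = \<phi> \<alpha> + \<phi> \<beta>" if "\<alpha> \<in> \<Delta>" "\<beta> \<in> \<Delta>" for \<alpha> \<beta>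
    using diff[of \<alpha> \<beta>] diff[of \<beta> \<alpha>] double that
    by (cases "\<alpha> = - b"; cases "\<beta> = - b") (auto simp: add.commute)
  then show ?thesis
    by (simp add: hom_on_def \<phi>_def)
qed

lemma skew_coeff: "skew_on \<Delta> (f \<delta>)"
  using coeff_skew unfolding skew_on_def by blast

text \<open>At shift \<open>b\<close> the factor \<alpha> + \<beta> + 2b splits as (\<alpha> + b) +
  (\<beta> + b), and skew-symmetry puts one part on each side.\<close>

lemma compat_coeff: "theta_compat \<Delta> b (f b)"
  unfolding theta_compat_def
proof (intro ballI)
  fix \<alpha> \<beta> \<gamma> assume "\<alpha> \<in> \<Delta>" "\<beta> \<in> \<Delta>" "\<gamma> \<in> \<Delta>"
  then show "(\<alpha> + b) * (f b (\<alpha> + \<gamma>) \<beta> - f b \<gamma> \<beta> - f b \<alpha> \<beta>) =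
    (\<beta> + b) * (f b (\<beta> + \<gamma>) \<alpha> - f b \<gamma> \<alpha> - f b \<beta> \<alpha>)"
    using coeff_compatible[of \<alpha> \<beta> \<gamma> b] coeff_skew[of \<alpha> \<beta> b] by (simp add: algebra_simps)
qed

lemma jacobi_coeffs:
  assumes "\<alpha> \<in> \<Delta>" "\<beta> \<in> \<Delta>" "\<gamma> \<in> \<Delta>"
  shows "f b \<alpha> \<beta> * f b (\<alpha> + \<beta> + b) \<gamma> + f b \<beta> \<gamma> * f b (\<beta> + \<gamma> + b) \<alpha> +
      f b \<gamma> \<alpha> * f b (\<gamma> + \<alpha> + b) \<beta> = 0" (is "?T = 0")
    and "f 0 0 b * ((\<gamma> + b) * f b \<alpha> \<beta> + (\<alpha> + b) * f b \<beta> \<gamma> + (\<beta> + b) * f b \<gamma> \<alpha>) = 0" (is "_ * ?S = 0")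
proof -
  let ?s = "\<alpha> + \<beta> + \<gamma>"
  have "br (br (xb \<alpha>) (xb \<beta>)) (xb \<gamma>) + br (br (xb \<beta>) (xb \<gamma>)) (xb \<alpha>) + br (br (xb \<gamma>) (xb \<alpha>)) (xb \<beta>) =
      scaleF ?T (xb (?s + 2 * b)) + scaleF (- (f 0 0 b / b) * ?S) (xb (?s + b))"
    by (rule jacobi_xb[OF lie.bilinear_algebra_axioms _ subgroup b(1) assms
        hom_coeff skew_coeff compat_coeff b(2)]) (rule bracket_eq)
  moreover have "br (br (xb \<alpha>) (xb \<beta>)) (xb \<gamma>) + br (br (xb \<beta>) (xb \<gamma>)) (xb \<alpha>) + br (br (xb \<gamma>) (xb \<alpha>)) (xb \<beta>) = 0"
    by (intro lie.jacobi xb_in_spaceF assms)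
  ultimately have "scaleF ?T (xb (?s + 2 * b)) + scaleF (- (f 0 0 b / b) * ?S) (xb (?s + b)) = 0"
    by simp
  then have "Poly_Mapping.lookup (scaleF ?T (xb (?s + 2 * b)) +
      scaleF (- (f 0 0 b / b) * ?S) (xb (?s + b))) k = 0" for k
    by simp
  \<comment> \<open>As b is nonzero, these exponents differ, so each evaluation isolates one
    coefficient.\<close>
  from this[of "?s + 2 * b"] this[of "?s + b"] show "?T = 0" "f 0 0 b * ?S = 0"
    using b by (simp_all add: lookup_add lookup_minus lookup_uminus lookup_xb)
qed

lemma zero_coeff:
  assumes "f 0 0 b \<noteq> 0"
  shows "zero_on \<Delta> (f b)"
  unfolding zero_on_def
proof (intro ballI)
  \<comment> \<open>At \<delta> = b the left side of \<open>coeff_formula\<close> vanishes; \<alpha>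
    = 0 then leaves \<open>b * f b 0 \<beta> = 0\<close>. Thus only one term of the cyclic sum
    survives at \<gamma> = 0.\<close>
  have f0: "f b 0 \<beta> = 0" "f b \<beta> 0 = 0" if "\<beta> \<in> \<Delta>" for \<beta>
    using coeff_formula[OF zero_in that, of b] coeff_skew[OF zero_in that, of b] b
    by (simp_all add: coeff_0_0)
  fix \<alpha> \<beta> assume "\<alpha> \<in> \<Delta>" "\<beta> \<in> \<Delta>"
  then show "f b \<alpha> \<beta> = 0"
    using jacobi_coeffs(2)[of \<alpha> \<beta> 0] assms b by (simp add: f0 zero_in)
qed

end

section \<open>Classification, construction and the bilinear examples combined\<close>

theorem theorem4p3:
  fixes \<Delta> :: "complex set" and b :: complex
  assumes "additive_subgroup_of \<Delta>" and "b \<in> \<Delta>" and "b \<noteq> 0"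
  shows
    "(\<forall>br. gelfand_dorfman_bialgebra scaleF (spaceF \<Delta>) br (nov_product b) \<longrightarrow>
        (\<exists>\<phi> \<theta>. hom_on \<Delta> \<phi> \<and> skew_on \<Delta> \<theta> \<and>
          (\<phi> b \<noteq> 0 \<longrightarrow> zero_on \<Delta> \<theta>) \<and>
          (\<phi> b = 0 \<longrightarrow> theta_compat \<Delta> b \<theta> \<and> theta_jacobi \<Delta> b \<theta>) \<and>
          (\<forall>\<alpha>\<in>\<Delta>. \<forall>\<beta>\<in>\<Delta>. br (xb \<alpha>) (xb \<beta>) = basis_bracket b \<phi> \<theta> \<alpha> \<beta>)))
     \<and>
     (\<forall>\<phi> \<theta>. hom_on \<Delta> \<phi> \<and> skew_on \<Delta> \<theta> \<and>
        (\<phi> b \<noteq> 0 \<longrightarrow> zero_on \<Delta> \<theta>) \<and>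
        (\<phi> b = 0 \<longrightarrow> theta_compat \<Delta> b \<theta> \<and> theta_jacobi \<Delta> b \<theta>) \<longrightarrow>
        gelfand_dorfman_bialgebra scaleF (spaceF \<Delta>)
          (bilinear_extension (basis_bracket b \<phi> \<theta>)) (nov_product b))
     \<and>
     (\<forall>\<phi> \<theta>. hom_on \<Delta> \<phi> \<and> \<phi> b = 0 \<and> skew_on \<Delta> \<theta> \<and> int_bilinear_on \<Delta> \<theta> \<and>
        ((\<forall>\<beta>\<in>\<Delta>. \<theta> b \<beta> = 0) \<or>
         (\<exists>\<phi>1 \<phi>2. hom_on \<Delta> \<phi>1 \<and> hom_on \<Delta> \<phi>2 \<and> \<phi>1 b = 0 \<and> \<phi>2 b = - 1 \<and>
           (\<forall>\<alpha>\<in>\<Delta>. \<forall>\<beta>\<in>\<Delta>. \<theta> \<alpha> \<beta> = \<phi>1 \<alpha> * \<phi>2 \<beta> - \<phi>1 \<beta> * \<phi>2 \<alpha>))) \<longrightarrow>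
        gelfand_dorfman_bialgebra scaleF (spaceF \<Delta>)
          (bilinear_extension (basis_bracket b \<phi> \<theta>)) (nov_product b))"
  (is "?classification \<and> ?construction \<and> ?bilinear")
proof (intro conjI)
  show ?classification
  proof (intro allI impI)
    fix br assume "gelfand_dorfman_bialgebra scaleF (spaceF \<Delta>) br (nov_product b)"
    then interpret xb_bracket \<Delta> br b
      using assms by (simp add: xb_bracket_def xb_bracket_axioms_def)
    show "\<exists>\<phi> \<theta>. hom_on \<Delta> \<phi> \<and> skew_on \<Delta> \<theta> \<and>
          (\<phi> b \<noteq> 0 \<longrightarrow> zero_on \<Delta> \<theta>) \<and>
          (\<phi> b = 0 \<longrightarrow> theta_compat \<Delta> b \<theta> \<and> theta_jacobi \<Delta> b \<theta>) \<and>
          (\<forall>\<alpha>\<in>\<Delta>. \<forall>\<beta>\<in>\<Delta>. br (xb \<alpha>) (xb \<beta>) = basis_bracket b \<phi> \<theta> \<alpha> \<beta>)"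
      using hom_coeff skew_coeff[of b] zero_coeff compat_coeff jacobi_coeffs(1) bracket_eq
      by (intro exI[of _ "f 0 0"] exI[of _ "f b"]) (simp add: theta_jacobi_def)
  qed
  show ?construction
  proof (intro allI impI)
    fix \<phi> \<theta>
    assume *: "hom_on \<Delta> \<phi> \<and> skew_on \<Delta> \<theta> \<and> (\<phi> b \<noteq> 0 \<longrightarrow> zero_on \<Delta> \<theta>) \<and>
        (\<phi> b = 0 \<longrightarrow> theta_compat \<Delta> b \<theta> \<and> theta_jacobi \<Delta> b \<theta>)"
    \<comment> \<open>For \<open>\<phi> b \<noteq> 0\<close> both conditions hold trivially, which
      lets one lemma cover both cases.\<close>
    have "theta_compat \<Delta> b \<theta> \<and> theta_jacobi \<Delta> b \<theta>" if "zero_on \<Delta> \<theta>"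
      using that additive_subgroup_ofD(2)[OF assms(1)]
      by (simp add: zero_on_def theta_compat_def theta_jacobi_def)
    with * show "gelfand_dorfman_bialgebra scaleF (spaceF \<Delta>)
        (bilinear_extension (basis_bracket b \<phi> \<theta>)) (nov_product b)"
      using assms by (intro gelfand_dorfman_basis_bracket) auto
  qed
  show ?bilinear
  proof (intro allI impI, elim conjE)
    fix \<phi> \<theta>
    assume *: "hom_on \<Delta> \<phi>" "\<phi> b = 0" "skew_on \<Delta> \<theta>" "int_bilinear_on \<Delta> \<theta>"
      and cases: "(\<forall>\<beta>\<in>\<Delta>. \<theta> b \<beta> = 0) \<or>
         (\<exists>\<phi>1 \<phi>2. hom_on \<Delta> \<phi>1 \<and> hom_on \<Delta> \<phi>2 \<and> \<phi>1 b = 0 \<and> \<phi>2 b = - 1 \<and>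
           (\<forall>\<alpha>\<in>\<Delta>. \<forall>\<beta>\<in>\<Delta>. \<theta> \<alpha> \<beta> = \<phi>1 \<alpha> * \<phi>2 \<beta> - \<phi>1 \<beta> * \<phi>2 \<alpha>))"
    from cases have "(\<forall>\<beta>\<in>\<Delta>. \<theta> b \<beta> = 0) \<or> (\<exists>\<phi>1 \<phi>2. \<phi>1 b = 0 \<and> \<phi>2 b = - 1 \<and>
           (\<forall>\<alpha>\<in>\<Delta>. \<forall>\<beta>\<in>\<Delta>. \<theta> \<alpha> \<beta> = \<phi>1 \<alpha> * \<phi>2 \<beta> - \<phi>1 \<beta> * \<phi>2 \<alpha>))"
      by (elim disj_forward ex_forward conjE) ((intro conjI)?; assumption)+
    note int_bilinear_theta_conditions[OF assms(1,2) *(3,4) this]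
    then show "gelfand_dorfman_bialgebra scaleF (spaceF \<Delta>)
        (bilinear_extension (basis_bracket b \<phi> \<theta>)) (nov_product b)"
      using assms * by (intro gelfand_dorfman_basis_bracket) auto
  qed
qed

end
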